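(* Let $G$ be a connected graph with at least two vertices. Then $\hom(G_2,Y(G))>\hom(G_2,\tilde Y(G))$.
   Context: All graphs are finite, simple and undirected. $\hom(F,H)$ is the number of homomorphisms (edge-preserving maps $V(F)\to V(H)$) from $F$ to $H$. The 2-subdivision $G_2$ of $G$ is obtained by replacing every edge $uv$ of $G$ by a path $u,w_{u,v},w_{v,u},v$ with two new vertices. For each vertex $u$ of $G$ let $A(u)=\{a(u,v): uv\in E(G)\}$ and $B(u)=\{b(u,v): uv\in E(G)\}$ be sets of new pairwise distinct elements, and let $M(u)$ be the set of all subsets of $A(u)$ of even cardinality, each regarded as a new vertex. The gadget $Y(u)$ has vertex set $A(u)\cup B(u)\cup M(u)$ and, for $m\in M(u)$, the edge $\{a(u,v),m\}$ if $a(u,v)\in m$ and the edge $\{b(u,v),m\}$ if $a(u,v)\notin m$. $Y(G)$ is the disjoint union of all gadgets $Y(u)$ together with, for each edge $uv\in E(G)$, the edges $\{a(u,v),a(v,u)\}$ and $\{b(u,v),b(v,u)\}$. $\tilde Y(G)$ is obtained from $Y(G)$ by choosing one edge $u_0v_0$ of $G$ and replacing $\{a(u_0,v_0),a(v_0,u_0)\}$, $\{b(u_0,v_0),b(v_0,u_0)\}$ by $\{a(u_0,v_0),b(v_0,u_0)\}$, $\{b(u_0,v_0),a(v_0,u_0)\}$ (up to isomorphism independent of the chosen edge). *)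

theory Defs
  imports "Graph_Theory.Digraph_Component" "Graph_Theory.Pair_Digraph" "HOL-Library.FuncSet"
begin

text \<open>
  A finite simple undirected graph is a \<^locale>\<open>pair_graph\<close>: an undirected edge \<open>uv\<close>
  is represented by the two arcs \<open>(u, v)\<close> and \<open>(v, u)\<close>.
\<close>

definition homs :: "'a pair_pre_digraph \<Rightarrow> 'b pair_pre_digraph \<Rightarrow> ('a \<Rightarrow> 'b) set" where
  "homs F H = {f \<in> pverts F \<rightarrow>\<^sub>E pverts H. \<forall>(x, y) \<in> parcs F. (f x, f y) \<in> parcs H}"

definition hom_count :: "'a pair_pre_digraph \<Rightarrow> 'b pair_pre_digraph \<Rightarrow> nat" where
  "hom_count F H = card (homs F H)"

text \<open>\<open>Sub (u, v)\<close> is the subdivision vertex $w_{u,v}$, the one adjacent to \<open>u\<close>.\<close>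

datatype 'a sub_vertex = Orig 'a | Sub "'a \<times> 'a"

definition two_subdivision :: "'a pair_pre_digraph \<Rightarrow> 'a sub_vertex pair_pre_digraph" where
  "two_subdivision G =
    \<lparr> pverts = Orig ` pverts G \<union> Sub ` parcs G,
      parcs = symcl ({(Orig u, Sub (u, v)) | u v. (u, v) \<in> parcs G}
                   \<union> {(Sub (u, v), Sub (v, u)) | u v. (u, v) \<in> parcs G}) \<rparr>"

text \<open>
  \<open>AV (u, v)\<close> is $a(u,v)$ and \<open>BV (u, v)\<close> is $b(u,v)$. \<open>MV u m\<close> is the element \<open>m\<close> of $M(u)$
  regarded as a vertex, where a subset of $A(u)$ is given by the set of the index pairs \<open>(u, v)\<close>
  of its elements. The tag \<open>u\<close> keeps the copies of the empty set in different $M(u)$ apart.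
\<close>

datatype 'a y_vertex = AV "'a \<times> 'a" | BV "'a \<times> 'a" | MV 'a "('a \<times> 'a) set"

definition out_pairs :: "'a pair_pre_digraph \<Rightarrow> 'a \<Rightarrow> ('a \<times> 'a) set" where
  "out_pairs G u = {(u, v) | v. (u, v) \<in> parcs G}"

definition even_subsets :: "'a pair_pre_digraph \<Rightarrow> 'a \<Rightarrow> ('a \<times> 'a) set set" where
  "even_subsets G u = {m. m \<subseteq> out_pairs G u \<and> even (card m)}"

definition gadget :: "'a pair_pre_digraph \<Rightarrow> 'a \<Rightarrow> 'a y_vertex pair_pre_digraph" where
  "gadget G u =
    \<lparr> pverts = AV ` out_pairs G u \<union> BV ` out_pairs G u \<union> MV u ` even_subsets G u,
      parcs = symcl ({(AV e, MV u m) | e m. e \<in> out_pairs G u \<and> m \<in> even_subsets G u \<and> e \<in> m}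
                   \<union> {(BV e, MV u m) | e m. e \<in> out_pairs G u \<and> m \<in> even_subsets G u \<and> e \<notin> m}) \<rparr>"

definition Y_graph :: "'a pair_pre_digraph \<Rightarrow> 'a y_vertex pair_pre_digraph" where
  "Y_graph G =
    \<lparr> pverts = (\<Union>u \<in> pverts G. pverts (gadget G u)),
      parcs = (\<Union>u \<in> pverts G. parcs (gadget G u))
        \<union> symcl ({(AV (u, v), AV (v, u)) | u v. (u, v) \<in> parcs G}
               \<union> {(BV (u, v), BV (v, u)) | u v. (u, v) \<in> parcs G}) \<rparr>"

definition Y_twisted :: "'a pair_pre_digraph \<Rightarrow> 'a \<Rightarrow> 'a \<Rightarrow> 'a y_vertex pair_pre_digraph" where
  "Y_twisted G u\<^sub>0 v\<^sub>0 =
    \<lparr> pverts = pverts (Y_graph G),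
      parcs = (parcs (Y_graph G)
                - symcl {(AV (u\<^sub>0, v\<^sub>0), AV (v\<^sub>0, u\<^sub>0)), (BV (u\<^sub>0, v\<^sub>0), BV (v\<^sub>0, u\<^sub>0))})
              \<union> symcl {(AV (u\<^sub>0, v\<^sub>0), BV (v\<^sub>0, u\<^sub>0)), (BV (u\<^sub>0, v\<^sub>0), AV (v\<^sub>0, u\<^sub>0))} \<rparr>"

lemma symcl_iff: "(x, y) \<in> symcl R \<longleftrightarrow> (x, y) \<in> R \<or> (y, x) \<in> R"
  by (auto simp: symcl_def)

lemma pair_graphI:
  assumes "finite (pverts G)"
    and "\<And>x y. (x, y) \<in> parcs G \<Longrightarrow> x \<in> pverts G \<and> y \<in> pverts G \<and> x \<noteq> y \<and> (y, x) \<in> parcs G"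
  shows "pair_graph G"
proof -
  have "parcs G \<subseteq> pverts G \<times> pverts G"
    using assms(2) by auto
  then have "finite (parcs G)"
    using assms(1) by (meson finite_SigmaI finite_subset)
  then show ?thesis
    using assms by unfold_locales (auto simp: symmetric_def sym_def)
qed

context pair_graph
begin

lemma parcs_sym: "(u, v) \<in> parcs G \<Longrightarrow> (v, u) \<in> parcs G"
  using pair_sym_arcs by (auto simp: symmetric_def sym_def)

lemma parcs_irrefl: "(u, u) \<notin> parcs G"
  using pair_no_loops by fastforce

lemma pair_graph_two_subdivision: "pair_graph (two_subdivision G)"
  by (rule pair_graphI)
    (auto simp: two_subdivision_def symcl_iff pair_finite_verts pair_finite_arcs parcs_irrefl
      intro: parcs_sym dest: in_arcsD1 in_arcsD2)

lemma finite_out_pairs: "finite (out_pairs G u)"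
  by (rule finite_subset[OF _ pair_finite_arcs]) (auto simp: out_pairs_def)

lemma finite_even_subsets: "finite (even_subsets G u)"
  by (rule finite_subset[of _ "Pow (out_pairs G u)"])
    (auto simp: even_subsets_def finite_out_pairs)

lemma pair_graph_gadget: "pair_graph (gadget G u)"
  by (rule pair_graphI)
    (auto simp: gadget_def symcl_iff finite_out_pairs finite_even_subsets)

lemma AV_in_Y_graph: "(u, v) \<in> parcs G \<Longrightarrow> AV (u, v) \<in> pverts (Y_graph G)"
  and BV_in_Y_graph: "(u, v) \<in> parcs G \<Longrightarrow> BV (u, v) \<in> pverts (Y_graph G)"
  by (auto simp: Y_graph_def gadget_def out_pairs_def intro!: bexI[of _ u] dest: in_arcsD1)

lemma pair_graph_Y_graph: "pair_graph (Y_graph G)"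
proof (rule pair_graphI)
  show "finite (pverts (Y_graph G))"
    using pair_finite_verts
    by (auto simp: Y_graph_def gadget_def finite_out_pairs finite_even_subsets)
next
  fix x y assume "(x, y) \<in> parcs (Y_graph G)"
  then consider
      (gadget) u where "u \<in> pverts G" "(x, y) \<in> parcs (gadget G u)"
    | (link) u v where "(u, v) \<in> parcs G"
        "x = AV (u, v) \<and> y = AV (v, u) \<or> x = BV (u, v) \<and> y = BV (v, u)"
    unfolding Y_graph_def by (auto simp: symcl_iff dest: parcs_sym)
  then show "x \<in> pverts (Y_graph G) \<and> y \<in> pverts (Y_graph G) \<and> x \<noteq> y \<and> (y, x) \<in> parcs (Y_graph G)"
  proof cases
    case gadget
    then show ?thesis by (force simp: Y_graph_def gadget_def symcl_iff)
  next
    case link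
    then have "(v, u) \<in> parcs G" "u \<noteq> v"
      using parcs_sym parcs_irrefl by auto
    with link show ?thesis
      using AV_in_Y_graph BV_in_Y_graph by (auto simp: Y_graph_def symcl_iff)
  qed
qed

lemma pair_graph_Y_twisted:
  assumes "(u\<^sub>0, v\<^sub>0) \<in> parcs G"
  shows "pair_graph (Y_twisted G u\<^sub>0 v\<^sub>0)"
proof -
  interpret Y: pair_graph "Y_graph G" by (rule pair_graph_Y_graph)
  show ?thesis
    using assms parcs_sym[OF assms] Y.pair_finite_verts
    by (intro pair_graphI)
      (auto simp: Y_twisted_def symcl_iff Y.parcs_irrefl
        intro: AV_in_Y_graph BV_in_Y_graph Y.parcs_sym dest: Y.in_arcsD1 Y.in_arcsD2)
qed

end

end

theory Submission
  imports Defs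
begin

text \<open>
  Both \<open>Y(G)\<close> and its twist project onto \<open>G\<^sub>2\<close>. Reading \<open>b\<close> as the bit 0, \<open>a\<close> as the bit 1 and a
  vertex of \<open>M(u)\<close> as a vector of bits, the lifts of a fixed map \<open>\<phi>\<close> to a homomorphism into \<open>Y(G)\<close>
  solve a homogeneous linear system over the field with two elements, and the lifts into the twist
  solve an inhomogeneous version of the same system. Adding a fixed twisted lift of \<open>\<phi>\<close> therefore
  maps the twisted lifts of \<open>\<phi>\<close> injectively to the untwisted ones. For \<open>\<phi> = id\<close> there is an
  untwisted lift but no twisted one: the arcs on which the bit is 1 are even in number, by the
  parity condition at each vertex of \<open>G\<close>, and come in pairs of opposite arcs except that exactly one
  of the two arcs of every twisted edge carries a 1, so the number of twisted edges is even.
\<close>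

section \<open>Parities of cardinalities\<close>

lemma even_card_sym_diff_iff:
  assumes "finite A" "finite B"
  shows "even (card (sym_diff A B)) \<longleftrightarrow> (even (card A) \<longleftrightarrow> even (card B))"
proof -
  have "card (sym_diff A B) = card (A - B) + card (B - A)"
    using assms by (intro card_Un_disjoint) auto
  moreover have "card A = card (A \<inter> B) + card (A - B)" "card B = card (A \<inter> B) + card (B - A)"
    using card_Int_Diff[OF assms(1), of B] card_Int_Diff[OF assms(2), of A]
    by (simp_all add: Int_commute)
  ultimately show ?thesis by presburger
qed

lemma even_card_fixpoint_free_involution:
  assumes "finite A"
    and "\<And>x. x \<in> A \<Longrightarrow> f x \<in> A" "\<And>x. x \<in> A \<Longrightarrow> f (f x) = x" "\<And>x. x \<in> A \<Longrightarrow> f x \<noteq> x"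
  shows "even (card A)"
proof -
  let ?orbits = "(\<lambda>x. {x, f x}) ` A"
  have orbits: "\<Union> ?orbits = A"
    using assms(2) by auto
  have "2 * card ?orbits = card (\<Union> ?orbits)"
  proof (rule card_partition)
    show "card c = 2" if "c \<in> ?orbits" for c
      using that assms(4) by (auto simp: card_2_iff)
    show "c \<inter> d = {}" if "c \<in> ?orbits" "d \<in> ?orbits" "c \<noteq> d" for c d
      using that assms(3) by auto metis+
  qed (use orbits assms(1) in auto)
  then show ?thesis
    using orbits by (metis dvd_triv_left)
qed

section \<open>Homomorphisms sorted by their projections\<close>

definition lifts ::
  "('b \<Rightarrow> 'c) \<Rightarrow> 'a pair_pre_digraph \<Rightarrow> 'b pair_pre_digraph \<Rightarrow> ('a \<Rightarrow> 'c) \<Rightarrow> ('a \<Rightarrow> 'b) set" where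
  "lifts p F H \<phi> = {h \<in> homs F H. (\<lambda>x\<in>pverts F. p (h x)) = \<phi>}"

lemma lifts_projD: "h \<in> lifts p F H \<phi> \<Longrightarrow> x \<in> pverts F \<Longrightarrow> p (h x) = \<phi> x"
  by (auto simp: lifts_def)

lemma lifts_vertsD: "h \<in> lifts p F H \<phi> \<Longrightarrow> x \<in> pverts F \<Longrightarrow> h x \<in> pverts H"
  by (auto simp: lifts_def homs_def)

lemma lifts_arcsD: "h \<in> lifts p F H \<phi> \<Longrightarrow> (x, y) \<in> parcs F \<Longrightarrow> (h x, h y) \<in> parcs H"
  by (auto simp: lifts_def homs_def)

lemma lifts_extensionalD: "h \<in> lifts p F H \<phi> \<Longrightarrow> h \<in> extensional (pverts F)"
  by (auto simp: lifts_def homs_def PiE_def)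

lemma lifts_projected_mapD: "h \<in> lifts p F H \<phi> \<Longrightarrow> \<phi> \<in> pverts F \<rightarrow>\<^sub>E p ` pverts H"
  by (auto simp: lifts_def homs_def)

lemma finite_homs:
  assumes "finite (pverts F)" "finite (pverts H)"
  shows "finite (homs F H)"
  by (rule finite_subset[OF _ finite_PiE[OF assms]]) (auto simp: homs_def)

lemma finite_lifts:
  assumes "finite (pverts F)" "finite (pverts H)"
  shows "finite (lifts p F H \<phi>)"
  using finite_homs[OF assms] by (simp add: lifts_def)

lemma hom_count_eq_sum_lifts:
  assumes "finite (pverts F)" "finite (pverts H)"
  shows "hom_count F H = (\<Sum>\<phi>\<in>pverts F \<rightarrow>\<^sub>E p ` pverts H. card (lifts p F H \<phi>))"
proof -
  let ?proj = "\<lambda>h. \<lambda>x\<in>pverts F. p (h x)"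
  have "?proj ` homs F H \<subseteq> pverts F \<rightarrow>\<^sub>E p ` pverts H"
    by (auto simp: homs_def)
  then have "(\<Sum>\<phi>\<in>pverts F \<rightarrow>\<^sub>E p ` pverts H. \<Sum>h | h \<in> homs F H \<and> ?proj h = \<phi>. 1 :: nat) =
      (\<Sum>h\<in>homs F H. 1)"
    using assms by (intro sum.group finite_homs finite_PiE) auto
  then show ?thesis
    by (simp add: hom_count_def lifts_def)
qed

lemma hom_count_less_if_card_lifts_le:
  assumes "finite (pverts F)" "finite (pverts H)" "pverts H' = pverts H"
    and le: "\<And>\<phi>. card (lifts p F H \<phi>) \<le> card (lifts p F H' \<phi>)"
    and less: "card (lifts p F H \<psi>) < card (lifts p F H' \<psi>)"
  shows "hom_count F H < hom_count F H'"
proof -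
  let ?maps = "pverts F \<rightarrow>\<^sub>E p ` pverts H"
  have "lifts p F H' \<psi> \<noteq> {}"
    using less by auto
  then have "\<psi> \<in> ?maps"
    using lifts_projected_mapD assms(3) by fastforce
  then have "(\<Sum>\<phi>\<in>?maps. card (lifts p F H \<phi>)) < (\<Sum>\<phi>\<in>?maps. card (lifts p F H' \<phi>))"
    using assms(1,2) le less by (intro sum_strict_mono_ex1 finite_PiE ballI bexI) auto
  then show ?thesis
    using assms(1-3) by (simp add: hom_count_eq_sum_lifts[where p = p])
qed

section \<open>Twists along a set of arcs\<close>

fun Y_adj :: "'a pair_pre_digraph \<Rightarrow> ('a \<times> 'a) set \<Rightarrow> 'a y_vertex \<Rightarrow> 'a y_vertex \<Rightarrow> bool" where
  "Y_adj G T (AV e) (AV e') \<longleftrightarrow> e \<in> parcs G \<and> e' = prod.swap e \<and> e \<notin> T"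
| "Y_adj G T (BV e) (BV e') \<longleftrightarrow> e \<in> parcs G \<and> e' = prod.swap e \<and> e \<notin> T"
| "Y_adj G T (AV e) (BV e') \<longleftrightarrow> e \<in> parcs G \<and> e' = prod.swap e \<and> e \<in> T"
| "Y_adj G T (BV e) (AV e') \<longleftrightarrow> e \<in> parcs G \<and> e' = prod.swap e \<and> e \<in> T"
| "Y_adj G T (AV e) (MV u m) \<longleftrightarrow> e \<in> out_pairs G u \<and> m \<in> even_subsets G u \<and> e \<in> m"
| "Y_adj G T (MV u m) (AV e) \<longleftrightarrow> e \<in> out_pairs G u \<and> m \<in> even_subsets G u \<and> e \<in> m"
| "Y_adj G T (BV e) (MV u m) \<longleftrightarrow> e \<in> out_pairs G u \<and> m \<in> even_subsets G u \<and> e \<notin> m"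
| "Y_adj G T (MV u m) (BV e) \<longleftrightarrow> e \<in> out_pairs G u \<and> m \<in> even_subsets G u \<and> e \<notin> m"
| "Y_adj G T (MV u m) (MV u' m') \<longleftrightarrow> False"

definition Y_twisted_on ::
  "'a pair_pre_digraph \<Rightarrow> ('a \<times> 'a) set \<Rightarrow> 'a y_vertex pair_pre_digraph" where
  "Y_twisted_on G T = \<lparr> pverts = pverts (Y_graph G), parcs = {(x, y). Y_adj G T x y} \<rparr>"

lemma pverts_Y_twisted_on [simp]: "pverts (Y_twisted_on G T) = pverts (Y_graph G)"
  by (simp add: Y_twisted_on_def)

lemma parcs_Y_twisted_on [simp]: "(x, y) \<in> parcs (Y_twisted_on G T) \<longleftrightarrow> Y_adj G T x y"
  by (simp add: Y_twisted_on_def)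

context pair_graph
begin

lemma parcs_Y_graph: "(x, y) \<in> parcs (Y_graph G) \<longleftrightarrow> Y_adj G {} x y"
  by (cases x; cases y)
    (auto simp: Y_graph_def gadget_def symcl_iff out_pairs_def dest: parcs_sym in_arcsD1)

lemma Y_graph_eq_Y_twisted_on: "Y_graph G = Y_twisted_on G {}"
  by (rule pair_pre_digraph.equality) (auto simp: parcs_Y_graph)

lemma parcs_Y_twisted:
  assumes "(u, v) \<in> parcs G"
  shows "(x, y) \<in> parcs (Y_twisted G u v) \<longleftrightarrow> Y_adj G {(u, v), (v, u)} x y"
  using assms parcs_sym[OF assms]
  by (cases x; cases y) (auto simp: Y_twisted_def symcl_iff parcs_Y_graph)

lemma Y_twisted_eq_Y_twisted_on:
  assumes "(u, v) \<in> parcs G"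
  shows "Y_twisted G u v = Y_twisted_on G {(u, v), (v, u)}"
proof (rule pair_pre_digraph.equality)
  show "pverts (Y_twisted G u v) = pverts (Y_twisted_on G {(u, v), (v, u)})"
    by (simp add: Y_twisted_def)
qed (auto simp: parcs_Y_twisted[OF assms])

end

section \<open>Addition of lifts\<close>

fun Y_proj :: "'a y_vertex \<Rightarrow> 'a sub_vertex" where
  "Y_proj (AV e) = Sub e"
| "Y_proj (BV e) = Sub e"
| "Y_proj (MV u m) = Orig u"

text \<open>Only meaningful for two vertices with the same projection.\<close>

fun Y_add :: "'a y_vertex \<Rightarrow> 'a y_vertex \<Rightarrow> 'a y_vertex" where
  "Y_add (AV e) (AV e') = BV e"
| "Y_add (BV e) (AV e') = AV e"
| "Y_add (MV u m) (MV u' m') = MV u (sym_diff m m')"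
| "Y_add x y = x"

lemma Y_proj_add: "Y_proj (Y_add x y) = Y_proj x"
  by (cases "(x, y)" rule: Y_add.cases) auto

lemma Y_add_cancel_right:
  assumes "Y_proj x = Y_proj z" "Y_proj y = Y_proj z" "Y_add x z = Y_add y z"
  shows "x = y"
  using assms by (cases x; cases y; cases z) auto

context pair_graph
begin

lemma sym_diff_even_subsets:
  assumes "m \<in> even_subsets G u" "m' \<in> even_subsets G u"
  shows "sym_diff m m' \<in> even_subsets G u"
proof -
  have "finite m" "finite m'"
    using assms finite_subset[OF _ finite_out_pairs] by (auto simp: even_subsets_def)
  then show ?thesis
    using assms even_card_sym_diff_iff unfolding even_subsets_def by blast
qed

lemma Y_add_in_Y_graph:
  assumes "x \<in> pverts (Y_graph G)" "y \<in> pverts (Y_graph G)" "Y_proj x = Y_proj y"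
  shows "Y_add x y \<in> pverts (Y_graph G)"
  using assms sym_diff_even_subsets
  by (cases "(x, y)" rule: Y_add.cases) (auto simp: Y_graph_def gadget_def image_iff)

lemma Y_adj_add:
  assumes "Y_adj G T x y" "Y_adj G T' x' y'" "Y_proj x = Y_proj x'" "Y_proj y = Y_proj y'"
  shows "Y_adj G (sym_diff T T') (Y_add x x') (Y_add y y')"
  using assms sym_diff_even_subsets
  by (cases x; cases y; cases x'; cases y') auto

end

definition lift_add ::
  "'b set \<Rightarrow> ('b \<Rightarrow> 'a y_vertex) \<Rightarrow> ('b \<Rightarrow> 'a y_vertex) \<Rightarrow> 'b \<Rightarrow> 'a y_vertex" where
  "lift_add V h g = (\<lambda>x\<in>V. Y_add (h x) (g x))"

lemma (in pair_graph) lift_add_in_lifts: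
  assumes "pair_wf_digraph F"
    and h: "h \<in> lifts Y_proj F (Y_twisted_on G T) \<phi>"
    and g: "g \<in> lifts Y_proj F (Y_twisted_on G T') \<phi>"
  shows "lift_add (pverts F) h g \<in> lifts Y_proj F (Y_twisted_on G (sym_diff T T')) \<phi>"
proof -
  interpret F: pair_wf_digraph F by fact
  note same_proj = trans[OF lifts_projD[OF h] lifts_projD[OF g, symmetric]]
  have "Y_adj G (sym_diff T T') (lift_add (pverts F) h g x) (lift_add (pverts F) h g y)"
    if "(x, y) \<in> parcs F" for x y
    using that lifts_arcsD[OF h that] lifts_arcsD[OF g that]
    by (simp add: lift_add_def F.in_arcsD1 F.in_arcsD2 Y_adj_add same_proj)
  moreover have "lift_add (pverts F) h g \<in> pverts F \<rightarrow>\<^sub>E pverts (Y_graph G)"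
    using lifts_vertsD[OF h] lifts_vertsD[OF g]
    by (auto simp: lift_add_def same_proj intro!: Y_add_in_Y_graph)
  moreover have "(\<lambda>x\<in>pverts F. Y_proj (lift_add (pverts F) h g x)) = \<phi>"
    using h by (auto simp: lifts_def lift_add_def Y_proj_add)
  ultimately show ?thesis
    by (auto simp: lifts_def homs_def)
qed

lemma inj_on_lift_add:
  assumes "g \<in> lifts Y_proj F H' \<phi>"
  shows "inj_on (\<lambda>h. lift_add (pverts F) h g) (lifts Y_proj F H \<phi>)"
proof (rule inj_onI)
  fix h k
  assume h: "h \<in> lifts Y_proj F H \<phi>" and k: "k \<in> lifts Y_proj F H \<phi>"
    and eq: "lift_add (pverts F) h g = lift_add (pverts F) k g"
  show "h = k"
  proof (rule extensionalityI[OF lifts_extensionalD[OF h] lifts_extensionalD[OF k]])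
    fix x assume x: "x \<in> pverts F"
    show "h x = k x"
    proof (rule Y_add_cancel_right)
      show "Y_proj (h x) = Y_proj (g x)" "Y_proj (k x) = Y_proj (g x)"
        using lifts_projD[OF h x] lifts_projD[OF k x] lifts_projD[OF assms x] by simp_all
      show "Y_add (h x) (g x) = Y_add (k x) (g x)"
        using fun_cong[OF eq, of x] x by (simp add: lift_add_def)
    qed
  qed
qed

lemma (in pair_graph) card_lifts_Y_twisted_on_le:
  assumes "pair_fin_digraph F"
  shows "card (lifts Y_proj F (Y_twisted_on G T) \<phi>) \<le> card (lifts Y_proj F (Y_twisted_on G {}) \<phi>)"
proof (cases "lifts Y_proj F (Y_twisted_on G T) \<phi> = {}")
  case False
  interpret F: pair_fin_digraph F by fact
  interpret Y: pair_graph "Y_graph G" by (rule pair_graph_Y_graph)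
  obtain g where g: "g \<in> lifts Y_proj F (Y_twisted_on G T) \<phi>"
    using False by blast
  have "lift_add (pverts F) h g \<in> lifts Y_proj F (Y_twisted_on G {}) \<phi>"
    if "h \<in> lifts Y_proj F (Y_twisted_on G T) \<phi>" for h
    using lift_add_in_lifts[OF F.pair_wf_digraph_axioms that g] by simp
  then show ?thesis
    using F.pair_finite_verts Y.pair_finite_verts
    by (intro card_inj_on_le[OF inj_on_lift_add[OF g]] finite_lifts) auto
qed simp

section \<open>Lifts of the identity\<close>

definition sections :: "'a pair_pre_digraph \<Rightarrow> ('a \<times> 'a) set \<Rightarrow> ('a sub_vertex \<Rightarrow> 'a y_vertex) set"
  where "sections G T =
    lifts Y_proj (two_subdivision G) (Y_twisted_on G T) (\<lambda>x\<in>pverts (two_subdivision G). x)"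

context pair_graph
begin

lemma swap_in_parcs_iff: "prod.swap e \<in> parcs G \<longleftrightarrow> e \<in> parcs G"
  by (cases e) (auto intro: parcs_sym)

lemma Orig_Sub_arc: "e \<in> out_pairs G u \<Longrightarrow> (Orig u, Sub e) \<in> parcs (two_subdivision G)"
  by (auto simp: two_subdivision_def symcl_iff out_pairs_def)

lemma Sub_Sub_arc: "e \<in> parcs G \<Longrightarrow> (Sub e, Sub (prod.swap e)) \<in> parcs (two_subdivision G)"
  by (cases e) (auto simp: two_subdivision_def symcl_iff)

lemma sections_untwisted_nonempty: "sections G {} \<noteq> {}"
proof -
  let ?F = "two_subdivision G"
  interpret F: pair_graph ?F by (rule pair_graph_two_subdivision)
  define zero where "zero = (\<lambda>x\<in>pverts ?F. case x of Orig u \<Rightarrow> MV u {} | Sub e \<Rightarrow> BV e)"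
  have "MV u {} \<in> pverts (Y_graph G)" if "u \<in> pverts G" for u
    using that by (auto simp: Y_graph_def gadget_def even_subsets_def intro!: bexI[of _ u])
  then have "zero \<in> pverts ?F \<rightarrow>\<^sub>E pverts (Y_graph G)"
    by (auto simp: zero_def two_subdivision_def intro: BV_in_Y_graph)
  moreover have "Y_adj G {} (zero x) (zero y)" if "(x, y) \<in> parcs ?F" for x y
    using that F.in_arcsD1[OF that] F.in_arcsD2[OF that]
    by (auto simp: zero_def two_subdivision_def symcl_iff out_pairs_def even_subsets_def
        intro: parcs_sym)
  moreover have "(\<lambda>x\<in>pverts ?F. Y_proj (zero x)) = (\<lambda>x\<in>pverts ?F. x)"
    by (auto simp: zero_def split: sub_vertex.split)
  ultimately have "zero \<in> sections G {}"
    by (auto simp: sections_def lifts_def homs_def)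
  then show ?thesis by blast
qed

end

locale twisted_section = pair_graph G for G :: "'a pair_pre_digraph" +
  fixes T :: "('a \<times> 'a) set" and h :: "'a sub_vertex \<Rightarrow> 'a y_vertex"
  assumes in_sections: "h \<in> sections G T"
begin

definition ones :: "('a \<times> 'a) set" where
  "ones = {e \<in> parcs G. h (Sub e) = AV e}"

lemma finite_ones: "finite ones"
  using pair_finite_arcs by (simp add: ones_def)

lemma Y_proj_section: "x \<in> pverts (two_subdivision G) \<Longrightarrow> Y_proj (h x) = x"
  using lifts_projD[OF in_sections[unfolded sections_def]] by simp

lemma Y_adj_section: "(x, y) \<in> parcs (two_subdivision G) \<Longrightarrow> Y_adj G T (h x) (h y)"
  using in_sections by (auto simp: sections_def dest: lifts_arcsD)

lemma section_Sub:
  assumes "e \<in> parcs G"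
  shows "h (Sub e) = (if e \<in> ones then AV e else BV e)"
  using Y_proj_section[of "Sub e"] assms
  by (cases "h (Sub e)") (auto simp: ones_def two_subdivision_def)

lemma section_Orig:
  assumes "u \<in> pverts G"
  obtains m where "h (Orig u) = MV u m"
  using Y_proj_section[of "Orig u"] assms
  by (cases "h (Orig u)") (auto simp: two_subdivision_def)

lemma swap_in_ones_iff:
  assumes "e \<in> parcs G"
  shows "prod.swap e \<in> ones \<longleftrightarrow> (e \<in> ones \<longleftrightarrow> e \<notin> T)"
  using Y_adj_section[OF Sub_Sub_arc[OF assms]] assms
  by (auto simp: section_Sub swap_in_parcs_iff split: if_splits)

lemma swap_in_twist_iff:
  assumes "e \<in> parcs G"
  shows "prod.swap e \<in> T \<longleftrightarrow> e \<in> T"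
  using swap_in_ones_iff[of e] swap_in_ones_iff[of "prod.swap e"] assms
  by (auto simp: swap_in_parcs_iff)

lemma even_card_ones_out_pairs:
  assumes "u \<in> pverts G"
  shows "even (card (ones \<inter> out_pairs G u))"
proof (cases "out_pairs G u = {}")
  case False
  obtain m where m: "h (Orig u) = MV u m"
    using section_Orig[OF assms] .
  have mem: "m \<in> even_subsets G u \<and> (e \<in> m \<longleftrightarrow> e \<in> ones)" if "e \<in> out_pairs G u" for e
  proof -
    have "e \<in> parcs G"
      using that by (auto simp: out_pairs_def)
    then show ?thesis
      using Y_adj_section[OF Orig_Sub_arc[OF that]] by (auto simp: m section_Sub split: if_splits)
  qed
  with False have "m \<in> even_subsets G u" by blast
  moreover from this have "ones \<inter> out_pairs G u = m"
    using mem by (auto simp: even_subsets_def)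
  ultimately show ?thesis
    by (simp add: even_subsets_def)
qed simp

lemma even_card_ones: "even (card ones)"
proof -
  have "ones = (\<Union>u\<in>pverts G. ones \<inter> out_pairs G u)"
    by (auto simp: ones_def out_pairs_def dest: in_arcsD1)
  also have "card \<dots> = (\<Sum>u\<in>pverts G. card (ones \<inter> out_pairs G u))"
    using finite_ones by (intro card_UN_disjoint pair_finite_verts) (auto simp: out_pairs_def)
  finally show ?thesis
    by (simp add: dvd_sum even_card_ones_out_pairs)
qed

lemma even_card_untwisted_ones: "even (card (ones - T))"
proof (rule even_card_fixpoint_free_involution[where f = prod.swap])
  fix e assume e: "e \<in> ones - T"
  then have arc: "e \<in> parcs G"
    by (simp add: ones_def)
  show "prod.swap e \<in> ones - T"
    using swap_in_ones_iff[OF arc] swap_in_twist_iff[OF arc] e by auto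
  show "prod.swap e \<noteq> e"
    using arc parcs_irrefl by (cases e) auto
qed (simp_all add: finite_ones)

lemma card_twist_eq:
  assumes "T \<subseteq> parcs G"
  shows "card T = 2 * card (ones \<inter> T)"
proof -
  have "prod.swap e \<in> ones \<inter> T \<longleftrightarrow> e \<in> T - ones" for e
  proof (cases "e \<in> parcs G")
    case True
    then show ?thesis
      using swap_in_ones_iff[of e] swap_in_twist_iff[of e] by auto
  next
    case False
    then show ?thesis
      using assms swap_in_parcs_iff[of e] by (auto simp: ones_def)
  qed
  then have "T - ones = {e. prod.swap e \<in> ones \<inter> T}"
    by blast
  also have "\<dots> = prod.swap ` (ones \<inter> T)"
    by force
  finally have "card (T - ones) = card (prod.swap ` (ones \<inter> T))"
    by simp
  then have "card (T - ones) = card (ones \<inter> T)"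
    by (simp add: card_image)
  moreover have "card T = card (T \<inter> ones) + card (T - ones)"
    using assms pair_finite_arcs by (intro card_Int_Diff) (rule finite_subset)
  ultimately show ?thesis
    by (simp add: Int_commute)
qed

lemma four_dvd_card_twist:
  assumes "T \<subseteq> parcs G"
  shows "4 dvd card T"
proof -
  have "card ones = card (ones \<inter> T) + card (ones - T)"
    using finite_ones by (rule card_Int_Diff)
  then have "even (card (ones \<inter> T))"
    using even_card_ones even_card_untwisted_ones by simp
  then show ?thesis
    using card_twist_eq[OF assms] by auto
qed

end

lemma (in pair_graph) sections_single_twist_empty:
  assumes "(u, v) \<in> parcs G"
  shows "sections G {(u, v), (v, u)} = {}"
proof -
  have "u \<noteq> v"
    using assms parcs_irrefl by auto
  then have "card {(u, v), (v, u)} = 2"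
    by simp
  moreover have "4 dvd card {(u, v), (v, u)}" if "h \<in> sections G {(u, v), (v, u)}" for h
  proof -
    interpret twisted_section G "{(u, v), (v, u)}" h
      by unfold_locales (rule that)
    show ?thesis
      using assms parcs_sym by (intro four_dvd_card_twist) auto
  qed
  ultimately show ?thesis by fastforce
qed

theorem theorem12p2:
  fixes G :: "'a pair_pre_digraph" and u\<^sub>0 v\<^sub>0 :: 'a
  assumes "pair_graph G"
    and "Digraph_Component.connected (with_proj G)"
    and "card (pverts G) \<ge> 2"
    and "(u\<^sub>0, v\<^sub>0) \<in> parcs G"
  shows "hom_count (two_subdivision G) (Y_graph G)
       > hom_count (two_subdivision G) (Y_twisted G u\<^sub>0 v\<^sub>0)"
proof -
  interpret pair_graph G by fact
  interpret F: pair_graph "two_subdivision G" by (rule pair_graph_two_subdivision)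
  interpret Y: pair_graph "Y_graph G" by (rule pair_graph_Y_graph)
  let ?F = "two_subdivision G" and ?T = "{(u\<^sub>0, v\<^sub>0), (v\<^sub>0, u\<^sub>0)}"
  have "card (sections G ?T) < card (sections G {})"
    using sections_untwisted_nonempty sections_single_twist_empty[OF assms(4)]
      F.pair_finite_verts Y.pair_finite_verts
    by (simp add: card_gt_0_iff finite_lifts sections_def)
  then have "hom_count ?F (Y_twisted_on G ?T) < hom_count ?F (Y_twisted_on G {})"
    using F.pair_finite_verts Y.pair_finite_verts
      card_lifts_Y_twisted_on_le[OF F.pair_fin_digraph_axioms]
    unfolding sections_def by (intro hom_count_less_if_card_lifts_le) auto
  then show ?thesis
    by (simp only: Y_graph_eq_Y_twisted_on Y_twisted_eq_Y_twisted_on[OF assms(4)])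
qed

end
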